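(* Let $p \in \mathbb{R}[x]$ and $g_1,\dots,g_m \in \mathbb{R}[x]$, where $x=(x_1,\dots,x_n)$, be such that $S=\{x\in \mathbb{R}^n: g_1(x)\ge 0,\dots,g_m(x) \ge 0\}$ is a non-empty compact set. Write $g(x)=(g_1(x),\dots,g_m(x))$. Let $T \subset \mathbb{R}^{n} \times \mathbb{R}^m_+$ be a compact set such that $\{(x,g(x)):x \in S\} \subseteq T$, and define $d_{\max}=\max \{2\deg g_1,\dots,2\deg g_m,\deg p\}$. Then $p(x)>0$ for all $x\in S$ if and only if there exists $F \in \mathcal{P}^+_{d_{\max}}(T)$ such that $$p(x) = F(x,g(x)) \quad\text{(as polynomials in } x).$$
   Context: $\mathbb{R}[x]$ is the ring of real polynomials in $x=(x_1,\dots,x_n)$, and $\mathbb{R}_+$ denotes the nonnegative reals. For a set $T\subseteq \mathbb{R}^{n+m}$ and $d\in\mathbb{N}$, $\mathcal{P}^+_d(T)$ is the set of real polynomials in $n+m$ variables $(x,u)$ of (total) degree at most $d$ that are strictly positive at every point of $T$. *)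

theory Defs
  imports "HOL-Analysis.Analysis" "HOL-Library.Poly_Mapping"
begin

(* Multivariate polynomials with variables indexed by a type: a monomial is a finitely
   supported exponent vector, a polynomial a finitely supported coefficient function on
   monomials.  The ring structure (convolution product) is the one of Poly_Mapping. *)
type_synonym ('v, 'r) mpoly = "('v \<Rightarrow>\<^sub>0 nat) \<Rightarrow>\<^sub>0 'r"

definition monom_deg :: "('v::finite \<Rightarrow>\<^sub>0 nat) \<Rightarrow> nat" where
  "monom_deg m = (\<Sum>i\<in>UNIV. Poly_Mapping.lookup m i)"

(* The zero polynomial gets degree 0. *)
definition total_deg :: "('v::finite, 'r::zero) mpoly \<Rightarrow> nat" where
  "total_deg p = Max (insert 0 (monom_deg ` Poly_Mapping.keys p))"

definition poly_eval :: "('v::finite, real) mpoly \<Rightarrow> ('v \<Rightarrow> real) \<Rightarrow> real" where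
  "poly_eval p a = (\<Sum>m\<in>Poly_Mapping.keys p. Poly_Mapping.lookup p m * (\<Prod>i\<in>UNIV. a i ^ Poly_Mapping.lookup m i))"

definition poly_const :: "real \<Rightarrow> ('v, real) mpoly" where
  "poly_const c = Poly_Mapping.single 0 c"

definition poly_var :: "'v \<Rightarrow> ('v, real) mpoly" where
  "poly_var i = Poly_Mapping.single (Poly_Mapping.single i 1) 1"

definition poly_subst ::
  "('v::finite, real) mpoly \<Rightarrow> ('v \<Rightarrow> ('w, real) mpoly) \<Rightarrow> ('w, real) mpoly" where
  "poly_subst p q = (\<Sum>m\<in>Poly_Mapping.keys p. poly_const (Poly_Mapping.lookup p m) * (\<Prod>i\<in>UNIV. q i ^ Poly_Mapping.lookup m i))"

(* Polynomials in (x, u) are indexed by the sum type: Inl i stands for x_i, Inr j for u_j. *)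
definition pos_polys ::
  "nat \<Rightarrow> ((real ^ 'n) \<times> (real ^ 'm)) set \<Rightarrow> ('n::finite + 'm::finite, real) mpoly set" where
  "pos_polys d T =
     {F. total_deg F \<le> d \<and>
         (\<forall>(x, u)\<in>T. poly_eval F (case_sum (\<lambda>i. x $ i) (\<lambda>j. u $ j)) > 0)}"

end

theory Submission
  imports Defs
begin

text \<open>
  If \<open>F(x, g(x)) = p(x)\<close> with \<open>F > 0\<close> on \<open>T\<close>, then \<open>p > 0\<close> on \<open>S\<close> because the graph of \<open>g\<close>
  over \<open>S\<close> lies in \<open>T\<close>. For the converse the representation is a penalised copy of \<open>p\<close>:
  \<open>F(x, u) = p(x) + c * (\<Sum>j. (u\<^sub>j - g\<^sub>j(x))\<^sup>2)\<close>.
  Substituting \<open>u = g(x)\<close> kills the penalty, so \<open>F(x, g(x)) = p(x)\<close> holds identically whatever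
  the constant \<open>c\<close>. At a point of \<open>T\<close> where the penalty vanishes, \<open>g(x) = u \<ge> 0\<close>; hence \<open>x \<in> S\<close>
  and \<open>p(x) > 0\<close>. By compactness of \<open>T\<close>, a large enough \<open>c\<close> then makes \<open>F\<close> positive on all
  of \<open>T\<close> (lemma \<open>compact_penalty\<close>).

  The degree of \<open>(u\<^sub>j - g\<^sub>j(x))\<^sup>2\<close> is \<open>2 * max 1 (deg g\<^sub>j)\<close>, which could exceed the required bound only
  if every \<open>g\<^sub>j\<close> were constant. But then \<open>S\<close>, being non-empty, would be the whole space, which is not
  compact.

  The rest is bookkeeping with polynomials: evaluation and substitution are ring homomorphisms, and
  the total degree is subadditive under products.
\<close>

section \<open>Evaluation and substitution as ring homomorphisms\<close>

lemma update_eq_add_single: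
  "m \<notin> Poly_Mapping.keys F \<Longrightarrow> Poly_Mapping.update m a F = F + Poly_Mapping.single m a"
  by (rule poly_mapping_eqI)
    (auto simp: lookup_update lookup_add lookup_single in_keys_iff when_def)

text \<open>
  Evaluation and substitution are two instances of the universal property of the polynomial ring: a
  ring homomorphism on the coefficients and a choice of images for the variables extend to a ring
  homomorphism on polynomials. The homomorphism laws are proved once, for both.
\<close>
locale coefficient_hom =
  fixes c :: "real \<Rightarrow> 'b::comm_ring_1"
  assumes one: "c 1 = 1"
    and add: "c (a + b) = c a + c b"
    and mult: "c (a * b) = c a * c b"
begin

lemma zero: "c 0 = 0"
  using add[of 0 0] by simp

definition extension :: "('v::finite \<Rightarrow> 'b) \<Rightarrow> ('v, real) mpoly \<Rightarrow> 'b" where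
  "extension q F = (\<Sum>m\<in>Poly_Mapping.keys F.
     c (Poly_Mapping.lookup F m) * (\<Prod>i\<in>UNIV. q i ^ Poly_Mapping.lookup m i))"

lemma extension_single:
  "extension q (Poly_Mapping.single m a) = c a * (\<Prod>i\<in>UNIV. q i ^ Poly_Mapping.lookup m i)"
  by (cases "a = 0") (simp_all add: extension_def zero)

lemma extension_zero: "extension q 0 = 0"
  by (simp add: extension_def)

lemma extension_add: "extension q (F + G) = extension q F + extension q G"
  unfolding extension_def
  by (rule setsum_keys_plus_distrib) (simp_all add: zero add algebra_simps)

lemma extension_single_mult:
  "extension q (Poly_Mapping.single m a * G) = extension q (Poly_Mapping.single m a) * extension q G"
proof (induction G rule: update_induct)
  case const
  show ?case by (simp add: extension_zero)
next
  case (update G k b)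
  have "extension q (Poly_Mapping.single m a * Poly_Mapping.single k b) =
        extension q (Poly_Mapping.single m a) * extension q (Poly_Mapping.single k b)"
    by (simp add: extension_single mult_single mult lookup_add power_add prod.distrib mult_ac)
  with update show ?case
    by (simp add: update_eq_add_single distrib_left extension_add)
qed

lemma extension_mult: "extension q (F * G) = extension q F * extension q G"
proof (induction F rule: update_induct)
  case const
  show ?case by (simp add: extension_zero)
next
  case (update F k b)
  then show ?case
    by (simp add: update_eq_add_single distrib_right extension_add extension_single_mult)
qed

lemma extension_const: "extension q (poly_const a) = c a"
  by (simp add: poly_const_def extension_single)

lemma extension_var: "extension q (poly_var i) = q i"
proof -
  have "(\<Prod>j\<in>UNIV. q j ^ Poly_Mapping.lookup (Poly_Mapping.single i (1::nat)) j) =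
        (\<Prod>j\<in>UNIV. if j = i then q j else 1)"
    by (rule prod.cong) (auto simp: lookup_single when_def)
  then show ?thesis
    by (simp add: poly_var_def extension_single one)
qed

end

interpretation real_coeff: coefficient_hom "\<lambda>a::real. a"
  rewrites "coefficient_hom.extension (\<lambda>a::real. a) = (\<lambda>a F. poly_eval F a)"
proof -
  show hom: "coefficient_hom (\<lambda>a::real. a)"
    by unfold_locales auto
  show "coefficient_hom.extension (\<lambda>a::real. a) = (\<lambda>a F. poly_eval F a)"
    by (intro ext) (simp add: coefficient_hom.extension_def[OF hom] poly_eval_def)
qed

interpretation poly_coeff: coefficient_hom poly_const
  rewrites "coefficient_hom.extension poly_const = (\<lambda>q F. poly_subst F q)"
proof -
  show hom: "coefficient_hom (poly_const :: real \<Rightarrow> ('w, real) mpoly)"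
    by unfold_locales (auto simp: poly_const_def single_add mult_single)
  show "coefficient_hom.extension (poly_const :: real \<Rightarrow> ('w, real) mpoly) = (\<lambda>q F. poly_subst F q)"
    by (intro ext) (simp add: coefficient_hom.extension_def[OF hom] poly_subst_def)
qed

lemmas poly_eval_simps = real_coeff.extension_add real_coeff.extension_mult
  real_coeff.extension_const real_coeff.extension_var real_coeff.extension_zero
lemmas poly_subst_simps = poly_coeff.extension_add poly_coeff.extension_mult
  poly_coeff.extension_const poly_coeff.extension_var poly_coeff.extension_zero

lemma single_eq_const_times_vars:
  "(Poly_Mapping.single m a :: ('v::finite, real) mpoly) =
     poly_const a * (\<Prod>i\<in>UNIV. poly_var i ^ Poly_Mapping.lookup m i)"
proof -
  have pow: "(poly_var i :: ('v, real) mpoly) ^ k = Poly_Mapping.single (Poly_Mapping.single i k) 1"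
    for i k
    by (induction k) (simp_all add: poly_var_def mult_single flip: single_add)
  have prod: "(\<Prod>i\<in>I. Poly_Mapping.single (f i) (1::real)) = Poly_Mapping.single (\<Sum>i\<in>I. f i) 1"
    if "finite I" for I :: "'v set" and f :: "'v \<Rightarrow> ('v \<Rightarrow>\<^sub>0 nat)"
    using that by (induction I) (simp_all add: mult_single)
  have "(\<Sum>i\<in>UNIV. Poly_Mapping.single i (Poly_Mapping.lookup m i)) = m"
    by (rule poly_mapping_eqI) (simp add: lookup_sum lookup_single when_def)
  then show ?thesis
    by (simp add: pow prod poly_const_def mult_single)
qed

text \<open>
  Constants and variables generate the polynomial ring, so identities between ring homomorphisms
  need to be checked only on these generators.
\<close>
lemma mpoly_induct [case_names const var add mult]:
  fixes F :: "('v::finite, real) mpoly"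
  assumes const: "\<And>a. P (poly_const a)"
    and var: "\<And>i. P (poly_var i)"
    and add: "\<And>F G. P F \<Longrightarrow> P G \<Longrightarrow> P (F + G)"
    and mult: "\<And>F G. P F \<Longrightarrow> P G \<Longrightarrow> P (F * G)"
  shows "P F"
proof (induction F rule: update_induct)
  case const
  show ?case using assms(1)[of 0] by (simp add: poly_const_def)
next
  case (update F m a)
  have one: "P 1" using const[of 1] by (simp add: poly_const_def)
  have pow: "P (poly_var i ^ k)" for i k
    by (induction k) (simp_all add: one var mult)
  have "P (\<Prod>i\<in>I. poly_var i ^ Poly_Mapping.lookup m i)" if "finite I" for I
    using that by (induction I) (simp_all add: one pow mult)
  then have "P (Poly_Mapping.single m a)"
    by (simp add: single_eq_const_times_vars const mult)
  with update show ?case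
    by (simp add: update_eq_add_single add)
qed

lemma poly_eval_subst: "poly_eval (poly_subst F q) a = poly_eval F (\<lambda>v. poly_eval (q v) a)"
  by (induction F rule: mpoly_induct) (simp_all add: poly_eval_simps poly_subst_simps)

lemma poly_eval_minus: "poly_eval (F - G) a = poly_eval F a - poly_eval G a"
  using real_coeff.extension_add[where F = "F - G" and G = G] by simp

lemma poly_subst_minus: "poly_subst (F - G) q = poly_subst F q - poly_subst G q"
  using poly_coeff.extension_add[where F = "F - G" and G = G and q = q] by (simp add: eq_diff_eq)

lemma poly_eval_sum: "poly_eval (\<Sum>i\<in>I. F i) a = (\<Sum>i\<in>I. poly_eval (F i) a)"
  by (induction I rule: infinite_finite_induct) (simp_all add: poly_eval_simps)

lemma poly_subst_sum: "poly_subst (\<Sum>i\<in>I. F i) a = (\<Sum>i\<in>I. poly_subst (F i) a)"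
  by (induction I rule: infinite_finite_induct) (simp_all add: poly_subst_simps)

section \<open>Continuity and total degree\<close>

lemma continuous_on_poly_eval:
  assumes "\<And>v. continuous_on A (\<lambda>z. f z v)"
  shows "continuous_on A (\<lambda>z. poly_eval F (f z))"
  unfolding poly_eval_def by (intro continuous_intros assms)

lemma total_deg_le_iff: "total_deg F \<le> d \<longleftrightarrow> (\<forall>m\<in>Poly_Mapping.keys F. monom_deg m \<le> d)"
  by (simp add: total_deg_def)

lemma monom_deg_le_total_deg: "m \<in> Poly_Mapping.keys F \<Longrightarrow> monom_deg m \<le> total_deg F"
  using total_deg_le_iff by blast

lemma total_deg_const: "total_deg (poly_const a) = 0"
  by (simp add: total_deg_def poly_const_def monom_deg_def)

lemma total_deg_var: "total_deg (poly_var i) = 1"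
  by (simp add: total_deg_def poly_var_def monom_deg_def lookup_single when_def)

lemma total_deg_add_le:
  "total_deg F \<le> d \<Longrightarrow> total_deg G \<le> d \<Longrightarrow> total_deg (F + G) \<le> d"
  unfolding total_deg_le_iff using keys_add[of F G] by blast

lemma total_deg_sum_le:
  "(\<And>i. i \<in> I \<Longrightarrow> total_deg (F i) \<le> d) \<Longrightarrow> total_deg (\<Sum>i\<in>I. F i) \<le> d"
  unfolding total_deg_le_iff using keys_sum[of F I] by blast

lemma total_deg_minus_le:
  fixes F G :: "('v::finite, real) mpoly"
  assumes "total_deg F \<le> d" "total_deg G \<le> d"
  shows "total_deg (F - G) \<le> d"
proof -
  have "Poly_Mapping.keys (F - G) \<subseteq> Poly_Mapping.keys F \<union> Poly_Mapping.keys G"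
    by (auto simp: in_keys_iff lookup_minus)
  with assms show ?thesis unfolding total_deg_le_iff by blast
qed

lemma total_deg_mult_le:
  fixes F G :: "('v::finite, real) mpoly"
  shows "total_deg (F * G) \<le> total_deg F + total_deg G"
  unfolding total_deg_le_iff
proof
  fix m assume "m \<in> Poly_Mapping.keys (F * G)"
  then obtain a b where m: "m = a + b" "a \<in> Poly_Mapping.keys F" "b \<in> Poly_Mapping.keys G"
    using keys_mult[of F G] by blast
  then have "monom_deg m = monom_deg a + monom_deg b"
    by (simp add: monom_deg_def lookup_add sum.distrib)
  with m show "monom_deg m \<le> total_deg F + total_deg G"
    by (simp add: add_mono monom_deg_le_total_deg)
qed

lemma total_deg_power_le:
  "total_deg ((F :: ('v::finite, real) mpoly) ^ k) \<le> k * total_deg F"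
proof (induction k)
  case 0
  show ?case using total_deg_const[of 1] by (simp add: poly_const_def)
next
  case (Suc k)
  then show ?case using total_deg_mult_le[of F "F ^ k"] by simp
qed

lemma total_deg_prod_le:
  "total_deg (\<Prod>i\<in>I. (F i :: ('v::finite, real) mpoly)) \<le> (\<Sum>i\<in>I. total_deg (F i))"
proof (induction I rule: infinite_finite_induct)
  case (insert i I)
  then show ?case using total_deg_mult_le[of "F i" "prod F I"] by simp
qed (use total_deg_const[of 1] in \<open>simp_all add: poly_const_def\<close>)

lemma total_deg_subst_le:
  assumes "\<And>i. total_deg (q i) \<le> d"
  shows "total_deg (poly_subst F q) \<le> d * total_deg F"
  unfolding poly_subst_def
proof (rule total_deg_sum_le)
  fix m assume m: "m \<in> Poly_Mapping.keys F"
  let ?M = "\<Prod>i\<in>UNIV. q i ^ Poly_Mapping.lookup m i"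
  have "total_deg (poly_const (Poly_Mapping.lookup F m) * ?M) \<le> total_deg ?M"
    using total_deg_mult_le[of "poly_const (Poly_Mapping.lookup F m)" ?M]
    by (simp add: total_deg_const)
  also have "\<dots> \<le> (\<Sum>i\<in>UNIV. total_deg (q i ^ Poly_Mapping.lookup m i))"
    by (rule total_deg_prod_le)
  also have "\<dots> \<le> (\<Sum>i\<in>UNIV. d * Poly_Mapping.lookup m i)"
    by (intro sum_mono order_trans[OF total_deg_power_le]) (simp add: assms mult.commute)
  also have "\<dots> = d * monom_deg m"
    by (simp add: monom_deg_def sum_distrib_left)
  also have "\<dots> \<le> d * total_deg F"
    using m by (simp add: monom_deg_le_total_deg)
  finally show "total_deg (poly_const (Poly_Mapping.lookup F m) * ?M) \<le> d * total_deg F" .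
qed

lemma poly_eval_total_deg_0:
  assumes "total_deg F = 0"
  shows "poly_eval F a = poly_eval F b"
proof -
  have "Poly_Mapping.lookup m i = 0" if "m \<in> Poly_Mapping.keys F" for m i
    using monom_deg_le_total_deg[OF that] assms by (simp add: monom_deg_def)
  then show ?thesis by (simp add: poly_eval_def)
qed

section \<open>Exact penalisation on a compact set\<close>

text \<open>
  Only the compact part \<open>K\<close> of \<open>T\<close> where \<open>f \<le> 0\<close> needs help from the penalty \<open>h\<close>. There \<open>h\<close> has no
  zero, so it is bounded below by a positive number, while \<open>f\<close> is bounded below; a suitable multiple
  of \<open>h\<close> therefore outweighs \<open>f\<close>.
\<close>
lemma compact_penalty:
  fixes f h :: "'a::topological_space \<Rightarrow> real"
  assumes T: "compact T" and f: "continuous_on T f" and h: "continuous_on T h"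
    and h_nonneg: "\<And>z. z \<in> T \<Longrightarrow> h z \<ge> 0"
    and pos: "\<And>z. z \<in> T \<Longrightarrow> h z = 0 \<Longrightarrow> f z > 0"
  obtains c where "\<And>z. z \<in> T \<Longrightarrow> f z + c * h z > 0"
proof -
  define K where "K = T \<inter> f -` {..0}"
  have K: "compact K"
    unfolding K_def using T continuous_closedin_preimage[OF f] closedin_compact by blast
  show ?thesis
  proof (cases "K = {}")
    case True
    then have "f z + 0 * h z > 0" if "z \<in> T" for z
      using that by (force simp: K_def)
    then show ?thesis by (rule that)
  next
    case False
    have fK: "continuous_on K f" and hK: "continuous_on K h"
      using f h by (auto simp: K_def intro: continuous_on_subset)
    obtain z0 where z0: "z0 \<in> K" "\<And>z. z \<in> K \<Longrightarrow> h z0 \<le> h z"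
      using continuous_attains_inf[OF K False hK] by blast
    obtain z1 where z1: "z1 \<in> K" "\<And>z. z \<in> K \<Longrightarrow> f z1 \<le> f z"
      using continuous_attains_inf[OF K False fK] by blast
    have h0: "h z0 > 0"
      using h_nonneg[of z0] pos[of z0] z0(1) by (force simp: K_def)
    \<comment> \<open>Chosen so that on \<open>K\<close> the sum is at least \<open>f z1 + c * h z0 = 1\<close>.\<close>
    define c where "c = (1 - f z1) / h z0"
    have c: "c \<ge> 0" using z1(1) h0 by (simp add: c_def K_def)
    have "f z + c * h z > 0" if z: "z \<in> T" for z
    proof (cases "z \<in> K")
      case True
      have "1 - f z1 = c * h z0" using h0 by (simp add: c_def)
      also have "\<dots> \<le> c * h z" using c z0(2)[OF True] by (rule mult_left_mono[rotated])
      finally show ?thesis using z1(2)[OF True] by simp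
    next
      case False
      then show ?thesis using z c h_nonneg[OF z] by (simp add: K_def add_pos_nonneg)
    qed
    then show ?thesis by (rule that)
  qed
qed

section \<open>Positive polynomials in the variables and the constraints\<close>

theorem theorem1:
  fixes p :: "('n::finite, real) mpoly"
    and g :: "'m::finite \<Rightarrow> ('n, real) mpoly"
    and S :: "(real ^ 'n) set"
    and T :: "((real ^ 'n) \<times> (real ^ 'm)) set"
    and d_max :: nat
  assumes S_def: "S = {x. \<forall>j. poly_eval (g j) (\<lambda>i. x $ i) \<ge> 0}"
    and S_nonempty: "S \<noteq> {}"
    and S_compact: "compact S"
    and T_nonneg: "T \<subseteq> UNIV \<times> {u. \<forall>j. u $ j \<ge> 0}"
    and T_compact: "compact T"
    and graph_subset: "{(x, \<chi> j. poly_eval (g j) (\<lambda>i. x $ i)) | x. x \<in> S} \<subseteq> T"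
    and d_max_def: "d_max = Max (insert (total_deg p) (range (\<lambda>j. 2 * total_deg (g j))))"
  shows "(\<forall>x\<in>S. poly_eval p (\<lambda>i. x $ i) > 0) \<longleftrightarrow>
         (\<exists>F \<in> pos_polys d_max T. p = poly_subst F (case_sum poly_var g))"
proof
  assume "\<exists>F \<in> pos_polys d_max T. p = poly_subst F (case_sum poly_var g)"
  then obtain F where F: "F \<in> pos_polys d_max T" and p: "p = poly_subst F (case_sum poly_var g)"
    by blast
  show "\<forall>x\<in>S. poly_eval p (\<lambda>i. x $ i) > 0"
  proof
    fix x assume "x \<in> S"
    let ?u = "\<chi> j. poly_eval (g j) (\<lambda>i. x $ i)"
    have "(x, ?u) \<in> T"
      using graph_subset \<open>x \<in> S\<close> by blast
    with F have "poly_eval F (case_sum (\<lambda>i. x $ i) (\<lambda>j. ?u $ j)) > 0"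
      unfolding pos_polys_def by blast
    also have "case_sum (\<lambda>i. x $ i) (\<lambda>j. ?u $ j) =
        (\<lambda>v. poly_eval (case_sum poly_var g v) (\<lambda>i. x $ i))"
      by (auto simp: poly_eval_simps split: sum.split)
    finally show "poly_eval p (\<lambda>i. x $ i) > 0"
      by (simp only: p poly_eval_subst)
  qed
next
  assume p_pos: "\<forall>x\<in>S. poly_eval p (\<lambda>i. x $ i) > 0"
  \<comment> \<open>A polynomial in \<open>x\<close>, read as a polynomial in \<open>(x, u)\<close>.\<close>
  define lift :: "('n, real) mpoly \<Rightarrow> ('n + 'm, real) mpoly"
    where "lift q = poly_subst q (\<lambda>i. poly_var (Inl i))" for q
  have lift_eval: "poly_eval (lift q) (case_sum a b) = poly_eval q a"
    for q and a :: "'n \<Rightarrow> real" and b :: "'m \<Rightarrow> real"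
    by (simp add: lift_def poly_eval_subst poly_eval_simps)
  have lift_subst: "poly_subst (lift q) (case_sum poly_var g) = q" for q
    unfolding lift_def
    by (induction q rule: mpoly_induct) (simp_all add: poly_subst_simps)
  have lift_deg: "total_deg (lift q) \<le> total_deg q" for q
    using total_deg_subst_le[of "\<lambda>i. poly_var (Inl i)" 1 q] by (simp add: lift_def total_deg_var)
  let ?D = "\<lambda>j. poly_var (Inr j) - lift (g j)"
  define H where "H = (\<Sum>j\<in>UNIV. ?D j * ?D j)"
  let ?pt = "\<lambda>z::(real ^ 'n) \<times> (real ^ 'm). case_sum (\<lambda>i. fst z $ i) (\<lambda>j. snd z $ j)"
  have H_eval: "poly_eval H (?pt z) = (\<Sum>j\<in>UNIV. (snd z $ j - poly_eval (g j) (\<lambda>i. fst z $ i))\<^sup>2)" for z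
    by (simp add: H_def poly_eval_sum poly_eval_simps poly_eval_minus lift_eval power2_eq_square)
  have pt_cont: "continuous_on T (\<lambda>z. poly_eval F (?pt z))" for F
  proof (rule continuous_on_poly_eval)
    show "continuous_on T (\<lambda>z. ?pt z v)" for v
      by (cases v) (simp_all add: continuous_on_fst continuous_on_snd continuous_on_component continuous_on_id)
  qed
  have "poly_eval (lift p) (?pt z) > 0" if "z \<in> T" "poly_eval H (?pt z) = 0" for z
  proof -
    have "snd z $ j = poly_eval (g j) (\<lambda>i. fst z $ i)" for j
      using that(2) by (simp add: H_eval sum_nonneg_eq_0_iff)
    moreover have "snd z $ j \<ge> 0" for j
      using that(1) T_nonneg by auto
    ultimately have "fst z \<in> S" by (simp add: S_def)
    then show ?thesis using p_pos by (simp add: lift_eval)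
  qed
  moreover have "poly_eval H (?pt z) \<ge> 0" for z
    by (simp add: H_eval sum_nonneg)
  ultimately obtain c where
    c: "\<And>z. z \<in> T \<Longrightarrow> poly_eval (lift p) (?pt z) + c * poly_eval H (?pt z) > 0"
    using compact_penalty[OF T_compact pt_cont[of "lift p"] pt_cont[of H]] by blast
  \<comment> \<open>A non-constant constraint forces \<open>d_max \<ge> 2\<close>, which makes room for the squares \<open>u\<^sub>j\<^sup>2\<close>.\<close>
  have "\<exists>j. total_deg (g j) \<noteq> 0"
  proof (rule ccontr)
    assume "\<nexists>j. total_deg (g j) \<noteq> 0"
    then have const: "poly_eval (g j) a = poly_eval (g j) b" for j a b
      using poly_eval_total_deg_0 by blast
    from S_nonempty obtain y where y: "poly_eval (g j) (\<lambda>i. y $ i) \<ge> 0" for j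
      by (auto simp: S_def)
    have "poly_eval (g j) (\<lambda>i. x $ i) \<ge> 0" for x and j
      using y[of j] const[of j "\<lambda>i. x $ i" "\<lambda>i. y $ i"] by simp
    then have "S = UNIV"
      by (simp add: S_def)
    then show False
      using S_compact compact_imp_bounded not_bounded_UNIV by metis
  qed
  then obtain j0 where "1 \<le> total_deg (g j0)"
    by (metis One_nat_def Suc_leI neq0_conv)
  have g_deg: "2 * total_deg (g j) \<le> d_max" for j
    unfolding d_max_def by (rule Max_ge) auto
  have p_deg: "total_deg p \<le> d_max"
    unfolding d_max_def by (rule Max_ge) auto
  have D_deg: "total_deg (?D j) \<le> d_max div 2" for j
  proof (rule total_deg_minus_le)
    show "total_deg (poly_var (Inr j)) \<le> d_max div 2"
      using g_deg[of j0] \<open>1 \<le> total_deg (g j0)\<close> by (simp add: total_deg_var)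
    show "total_deg (lift (g j)) \<le> d_max div 2"
      using g_deg[of j] lift_deg[of "g j"] by simp
  qed
  have H_deg: "total_deg H \<le> d_max"
    unfolding H_def
  proof (rule total_deg_sum_le)
    fix j
    have "total_deg (?D j * ?D j) \<le> total_deg (?D j) + total_deg (?D j)"
      by (rule total_deg_mult_le)
    also have "\<dots> \<le> d_max" using D_deg[of j] by linarith
    finally show "total_deg (?D j * ?D j) \<le> d_max" .
  qed
  define F where "F = lift p + poly_const c * H"
  have "total_deg F \<le> d_max"
    unfolding F_def
  proof (rule total_deg_add_le)
    show "total_deg (lift p) \<le> d_max"
      using lift_deg p_deg by (rule order_trans)
    show "total_deg (poly_const c * H) \<le> d_max"
      using total_deg_mult_le[of "poly_const c" H] H_deg by (simp add: total_deg_const)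
  qed
  moreover have "poly_eval F (case_sum (\<lambda>i. x $ i) (\<lambda>j. u $ j)) > 0" if "(x, u) \<in> T" for x u
    using c[OF that] by (simp add: F_def poly_eval_simps)
  ultimately have "F \<in> pos_polys d_max T"
    unfolding pos_polys_def by blast
  moreover have "poly_subst F (case_sum poly_var g) = p"
    by (simp add: F_def H_def poly_subst_simps poly_subst_sum poly_subst_minus lift_subst)
  ultimately show "\<exists>F \<in> pos_polys d_max T. p = poly_subst F (case_sum poly_var g)"
    by metis
qed

end
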